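(* Suppose that the reconstruction operator satisfies $\mathcal R(0,\dots,0)=0$. Let $U^*:\mathbb R\to\Omega$ be a stationary solution of $U_t+F(U)_x=S(U)H_x$. Then the vector of point values $\{U^*(x_i)\}$ is an equilibrium of the ODE system given by the semi-discrete method $$\frac{dU_i}{dt}+\frac{1}{\Delta x}\left(\widehat{\mathcal F}_{i,i+1/2}-\widehat{\mathcal F}_{i,i-1/2}\right)=0$$ described in the context; that is, if the numerical fluxes are computed from $U_j=U^*(x_j)$ for all $j$, then $\widehat{\mathcal F}_{i,i+1/2}-\widehat{\mathcal F}_{i,i-1/2}=0$ for every $i$.
   Context: Setting. $\Omega\subset\mathbb R^N$ is open, $F:\Omega\to\mathbb R^N$ (flux) and $S:\Omega\to\mathbb R^N$ are smooth, the Jacobian $J(U)$ of $F$ has $N$ distinct real eigenvalues, all different from $0$, for every $U\in\Omega$, and $H:\mathbb R\to\mathbb R$ is continuous and a.e. differentiable. A stationary solution on an interval is a locally absolutely continuous function $U^*$ with values in $\Omega$ satisfying $\frac{d}{dx}F(U^*(x))=S(U^*(x))H_x(x)$ at every point of the interval where $H$ is differentiable. Standing assumption: for every node $x_i$ and every $U_i\in\Omega$ the Cauchy problem of finding a stationary solution with value $U_i$ at $x_i$ has a unique maximal solution. Mesh. Uniform nodes $x_j$ with step $\Delta x$ ($x_{j+1}-x_j=\Delta x$). Reconstruction operator. Fix integers $r,s\ge0$ and a map $\mathcal R:(\mathbb R^N)^{r+s+1}\to\mathbb R^N$. Numerical fluxes. Given values $U_j\in\Omega$ at the nodes, for each $i$: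 (1) let $U_i^*$ be the maximal stationary solution with $U_i^*(x_i)=U_i$ (assumed defined at $x_{i-r-1},\dots,x_{i+s}$; when it is not, a different, standard scheme is used for that $i$); (2) put $\mathcal F_j=F(U_j)-F(U_i^*(x_j))$ for $j=i-1-r,\dots,i+s$; (3) put $\widehat{\mathcal F}_{i,i+1/2}=\mathcal R(\mathcal F_{i-r},\dots,\mathcal F_{i+s})$ and $\widehat{\mathcal F}_{i,i-1/2}=\mathcal R(\mathcal F_{i-1-r},\dots,\mathcal F_{i-1+s})$. *)

theory Defs
  imports "HOL-Analysis.Analysis"
begin

text \<open>\<open>C\<close>-infinity on an open set: all iterated directional derivatives exist and are continuous.\<close>

primrec C_k_on ::
    "nat \<Rightarrow> ('a::real_normed_vector) set \<Rightarrow> ('a \<Rightarrow> 'b::real_normed_vector) \<Rightarrow> bool" where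
  "C_k_on 0 A f \<longleftrightarrow> continuous_on A f"
| "C_k_on (Suc k) A f \<longleftrightarrow> (\<forall>u\<in>A. f differentiable (at u)) \<and>
     (\<forall>v. C_k_on k A (\<lambda>u. frechet_derivative f (at u) v))"

definition smooth_on :: "('a::real_normed_vector) set \<Rightarrow> ('a \<Rightarrow> 'b::real_normed_vector) \<Rightarrow> bool" where
  "smooth_on A f \<longleftrightarrow> (\<forall>k. C_k_on k A f)"

definition real_eigenvalues :: "real ^ 'n ^ 'n \<Rightarrow> real set" where
  "real_eigenvalues A = {c. \<exists>v. v \<noteq> 0 \<and> A *v v = c *\<^sub>R v}"

text \<open>The members of a division \<open>D\<close> of \<open>T\<close> are compact intervals with disjoint interiors, so
  \<open>Inf K\<close> and \<open>Sup K\<close> are the endpoints of \<open>K\<close> and \<open>measure lborel K\<close> is its length.\<close>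

definition abs_continuous_on :: "real set \<Rightarrow> (real \<Rightarrow> 'a::real_normed_vector) \<Rightarrow> bool" where
  "abs_continuous_on I f \<longleftrightarrow> (\<forall>e>0. \<exists>d>0. \<forall>D T.
     D division_of T \<and> T \<subseteq> I \<and> (\<Sum>K\<in>D. measure lborel K) < d
       \<longrightarrow> (\<Sum>K\<in>D. norm (f (Sup K) - f (Inf K))) < e)"

definition locally_abs_continuous_on :: "real set \<Rightarrow> (real \<Rightarrow> 'a::real_normed_vector) \<Rightarrow> bool" where
  "locally_abs_continuous_on I f \<longleftrightarrow> (\<forall>a b. {a..b} \<subseteq> I \<longrightarrow> abs_continuous_on {a..b} f)"

text \<open>Intervals are nondegenerate; at an endpoint belonging to \<open>I\<close> the derivative of
  \<open>F \<circ> V\<close> is one-sided.\<close>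

definition stationary_solution_on ::
    "(real ^ 'n) set \<Rightarrow> (real ^ 'n \<Rightarrow> real ^ 'n) \<Rightarrow> (real ^ 'n \<Rightarrow> real ^ 'n) \<Rightarrow> (real \<Rightarrow> real)
      \<Rightarrow> real set \<Rightarrow> (real \<Rightarrow> real ^ 'n) \<Rightarrow> bool" where
  "stationary_solution_on \<Omega> F S H I V \<longleftrightarrow>
     is_interval I \<and> interior I \<noteq> {} \<and>
     locally_abs_continuous_on I V \<and> V ` I \<subseteq> \<Omega> \<and>
     (\<forall>y\<in>I. H differentiable (at y) \<longrightarrow>
        ((\<lambda>z. F (V z)) has_vector_derivative (deriv H y *\<^sub>R S (V y))) (at y within I))"

text \<open>Solutions on an unspecified interval are partial functions, the interval being the domain,
  so that extension of solutions is \<open>\<subseteq>\<^sub>m\<close>.\<close>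

definition cauchy_solution ::
    "(real ^ 'n) set \<Rightarrow> (real ^ 'n \<Rightarrow> real ^ 'n) \<Rightarrow> (real ^ 'n \<Rightarrow> real ^ 'n) \<Rightarrow> (real \<Rightarrow> real)
      \<Rightarrow> real \<Rightarrow> real ^ 'n \<Rightarrow> (real \<rightharpoonup> real ^ 'n) \<Rightarrow> bool" where
  "cauchy_solution \<Omega> F S H y0 u0 W \<longleftrightarrow>
     W y0 = Some u0 \<and> stationary_solution_on \<Omega> F S H (dom W) (\<lambda>y. the (W y))"

definition maximal_solution ::
    "(real ^ 'n) set \<Rightarrow> (real ^ 'n \<Rightarrow> real ^ 'n) \<Rightarrow> (real ^ 'n \<Rightarrow> real ^ 'n) \<Rightarrow> (real \<Rightarrow> real)
      \<Rightarrow> real \<Rightarrow> real ^ 'n \<Rightarrow> (real \<rightharpoonup> real ^ 'n) \<Rightarrow> bool" where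
  "maximal_solution \<Omega> F S H y0 u0 W \<longleftrightarrow>
     cauchy_solution \<Omega> F S H y0 u0 W \<and>
     (\<forall>W'. cauchy_solution \<Omega> F S H y0 u0 W' \<and> W \<subseteq>\<^sub>m W' \<longrightarrow> W' = W)"

definition local_stationary ::
    "(real ^ 'n) set \<Rightarrow> (real ^ 'n \<Rightarrow> real ^ 'n) \<Rightarrow> (real ^ 'n \<Rightarrow> real ^ 'n) \<Rightarrow> (real \<Rightarrow> real)
      \<Rightarrow> (int \<Rightarrow> real) \<Rightarrow> (int \<Rightarrow> real ^ 'n) \<Rightarrow> int \<Rightarrow> (real \<rightharpoonup> real ^ 'n)" where
  "local_stationary \<Omega> F S H x U i = (THE W. maximal_solution \<Omega> F S H (x i) (U i) W)"

definition flux_difference ::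
    "(real ^ 'n) set \<Rightarrow> (real ^ 'n \<Rightarrow> real ^ 'n) \<Rightarrow> (real ^ 'n \<Rightarrow> real ^ 'n) \<Rightarrow> (real \<Rightarrow> real)
      \<Rightarrow> (int \<Rightarrow> real) \<Rightarrow> (int \<Rightarrow> real ^ 'n) \<Rightarrow> int \<Rightarrow> int \<Rightarrow> real ^ 'n" where
  "flux_difference \<Omega> F S H x U i j =
     F (U j) - F (the (local_stationary \<Omega> F S H x U i (x j)))"

text \<open>The reconstruction operator \<open>R\<close> takes a list and is only ever applied to lists of length
  \<open>r + s + 1\<close>. With \<open>k = i\<close> the following is the flux at \<open>i + 1/2\<close>, with \<open>k = i - 1\<close> the one at
  \<open>i - 1/2\<close>, both built from the stationary solution through \<open>(x i, U i)\<close>.\<close>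

definition reconstructed_flux ::
    "(real ^ 'n) set \<Rightarrow> (real ^ 'n \<Rightarrow> real ^ 'n) \<Rightarrow> (real ^ 'n \<Rightarrow> real ^ 'n) \<Rightarrow> (real \<Rightarrow> real)
      \<Rightarrow> (int \<Rightarrow> real) \<Rightarrow> nat \<Rightarrow> nat \<Rightarrow> ((real ^ 'n) list \<Rightarrow> real ^ 'n)
      \<Rightarrow> (int \<Rightarrow> real ^ 'n) \<Rightarrow> int \<Rightarrow> int \<Rightarrow> real ^ 'n" where
  "reconstructed_flux \<Omega> F S H x r s R U i k =
     R (map (flux_difference \<Omega> F S H x U i) [k - int r .. k + int s])"

definition flux_right ::
    "(real ^ 'n) set \<Rightarrow> (real ^ 'n \<Rightarrow> real ^ 'n) \<Rightarrow> (real ^ 'n \<Rightarrow> real ^ 'n) \<Rightarrow> (real \<Rightarrow> real)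
      \<Rightarrow> (int \<Rightarrow> real) \<Rightarrow> nat \<Rightarrow> nat \<Rightarrow> ((real ^ 'n) list \<Rightarrow> real ^ 'n)
      \<Rightarrow> (int \<Rightarrow> real ^ 'n) \<Rightarrow> int \<Rightarrow> real ^ 'n" where
  "flux_right \<Omega> F S H x r s R U i = reconstructed_flux \<Omega> F S H x r s R U i i"

definition flux_left ::
    "(real ^ 'n) set \<Rightarrow> (real ^ 'n \<Rightarrow> real ^ 'n) \<Rightarrow> (real ^ 'n \<Rightarrow> real ^ 'n) \<Rightarrow> (real \<Rightarrow> real)
      \<Rightarrow> (int \<Rightarrow> real) \<Rightarrow> nat \<Rightarrow> nat \<Rightarrow> ((real ^ 'n) list \<Rightarrow> real ^ 'n)
      \<Rightarrow> (int \<Rightarrow> real ^ 'n) \<Rightarrow> int \<Rightarrow> real ^ 'n" where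
  "flux_left \<Omega> F S H x r s R U i = reconstructed_flux \<Omega> F S H x r s R U i (i - 1)"

text \<open>Right-hand side of the semi-discrete method. At a node whose maximal stationary solution does
  not reach the whole stencil, another scheme, given by its right-hand side \<open>alt\<close>, is used.\<close>

definition semi_discrete_rhs ::
    "(real ^ 'n) set \<Rightarrow> (real ^ 'n \<Rightarrow> real ^ 'n) \<Rightarrow> (real ^ 'n \<Rightarrow> real ^ 'n) \<Rightarrow> (real \<Rightarrow> real)
      \<Rightarrow> (int \<Rightarrow> real) \<Rightarrow> real \<Rightarrow> nat \<Rightarrow> nat \<Rightarrow> ((real ^ 'n) list \<Rightarrow> real ^ 'n)
      \<Rightarrow> ((int \<Rightarrow> real ^ 'n) \<Rightarrow> int \<Rightarrow> real ^ 'n)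
      \<Rightarrow> (int \<Rightarrow> real ^ 'n) \<Rightarrow> int \<Rightarrow> real ^ 'n" where
  "semi_discrete_rhs \<Omega> F S H x dx r s R alt U i =
     (if x ` {i - int r - 1 .. i + int s} \<subseteq> dom (local_stationary \<Omega> F S H x U i)
      then - ((1 / dx) *\<^sub>R (flux_right \<Omega> F S H x r s R U i - flux_left \<Omega> F S H x r s R U i))
      else alt U i)"

text \<open>Equilibrium in the state space of grid functions with values in \<open>\<Omega>\<close> of the system
  \<open>dU\<^sub>i/dt = G U i\<close>.\<close>

definition equilibrium ::
    "'a set \<Rightarrow> ((int \<Rightarrow> 'a) \<Rightarrow> int \<Rightarrow> 'b::zero) \<Rightarrow> (int \<Rightarrow> 'a) \<Rightarrow> bool" where
  "equilibrium \<Omega> G U \<longleftrightarrow> (\<forall>i. U i \<in> \<Omega>) \<and> (\<forall>i. G U i = 0)"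

end

theory Submission
  imports Defs
begin

text \<open>A stationary solution defined on the whole line admits no proper extension, so by uniqueness
  it is the maximal stationary solution through each of its values. Every flux difference is
  therefore zero, and so is its reconstruction.\<close>

lemma maximal_solution_Some:
  assumes "stationary_solution_on \<Omega> F S H UNIV V"
  shows "maximal_solution \<Omega> F S H y (V y) (\<lambda>z. Some (V z))"
proof -
  \<comment> \<open>Since \<open>Some (V z)\<close> is defined at every real \<open>z\<close>,
    \<open>\<subseteq>\<^sub>m\<close> leaves \<open>W'\<close> no new point to take a value at;
    maximality then reduces to being a Cauchy solution.\<close>
  have "W' = (\<lambda>z. Some (V z))" if "(\<lambda>z. Some (V z)) \<subseteq>\<^sub>m W'" for W'
    using that by (fastforce simp: map_le_def dom_def)
  with assms show ?thesis
    by (auto simp: maximal_solution_def cauchy_solution_def dom_def)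
qed

text \<open>The uniqueness assumption is what gives the \<open>THE\<close> in
  \<open>local_stationary\<close> a determined value; the global solution is a witness, hence that
  value.\<close>

lemma local_stationary_eq_global:
  assumes "\<exists>!W. maximal_solution \<Omega> F S H (x i) (V (x i)) W"
    and "stationary_solution_on \<Omega> F S H UNIV V"
  shows "local_stationary \<Omega> F S H x (\<lambda>j. V (x j)) i = (\<lambda>z. Some (V z))"
  unfolding local_stationary_def
  using assms maximal_solution_Some by (intro the1_equality)

text \<open>The stencil centre \<open>k\<close> is kept independent of \<open>i\<close>, so that one
  statement serves both half-node fluxes: \<open>k = i\<close> and \<open>k = i - 1\<close>, with
  the same stationary solution through node \<open>i\<close>.\<close>

lemma reconstructed_flux_eq_R_zeros:
  assumes "\<exists>!W. maximal_solution \<Omega> F S H (x i) (V (x i)) W"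
    and "stationary_solution_on \<Omega> F S H UNIV V"
  shows "reconstructed_flux \<Omega> F S H x r s R (\<lambda>j. V (x j)) i k = R (replicate (r + s + 1) 0)"
proof -
  have "map (flux_difference \<Omega> F S H x (\<lambda>j. V (x j)) i) [k - int r..k + int s]
      = map (\<lambda>_. 0) [k - int r..k + int s]"
    by (simp add: flux_difference_def local_stationary_eq_global[where x = x and i = i and V = V, OF assms])
  \<comment> \<open>The centre \<open>k\<close> cancels in the length of the integer range, whose
    two ends are both included.\<close>
  also have "\<dots> = replicate (nat (int r + int s + 1)) 0"
    by (simp add: map_replicate_const algebra_simps)
  also have "nat (int r + int s + 1) = r + s + 1"
    by simp
  finally show ?thesis
    by (simp add: reconstructed_flux_def)
qed

theorem proposition2:
  fixes \<Omega> :: "(real ^ 'n) set"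
    and F S :: "real ^ 'n \<Rightarrow> real ^ 'n"
    and H :: "real \<Rightarrow> real"
    and x :: "int \<Rightarrow> real" and dx :: real
    and r s :: nat
    and R :: "(real ^ 'n) list \<Rightarrow> real ^ 'n"
    and alt :: "(int \<Rightarrow> real ^ 'n) \<Rightarrow> int \<Rightarrow> real ^ 'n"
    and Ustar :: "real \<Rightarrow> real ^ 'n"
  assumes "open \<Omega>"
    and "smooth_on \<Omega> F" and "smooth_on \<Omega> S"
    and "\<And>u. u \<in> \<Omega> \<Longrightarrow> card (real_eigenvalues (jacobian F (at u))) = CARD('n)"
    and "\<And>u. u \<in> \<Omega> \<Longrightarrow> 0 \<notin> real_eigenvalues (jacobian F (at u))"
    and "continuous_on UNIV H" and "AE y in lebesgue. H differentiable (at y)"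
    and "dx > 0" and "\<And>j. x (j + 1) - x j = dx"
    and "\<And>i u. u \<in> \<Omega> \<Longrightarrow> \<exists>!W. maximal_solution \<Omega> F S H (x i) u W"
    and "R (replicate (r + s + 1) 0) = 0"
    and "stationary_solution_on \<Omega> F S H UNIV Ustar"
  shows "equilibrium \<Omega> (semi_discrete_rhs \<Omega> F S H x dx r s R alt) (\<lambda>i. Ustar (x i)) \<and>
    (\<forall>i. flux_right \<Omega> F S H x r s R (\<lambda>j. Ustar (x j)) i
       - flux_left \<Omega> F S H x r s R (\<lambda>j. Ustar (x j)) i = 0)"
proof -
  \<comment> \<open>Used twice: for membership in the state space, and to instantiate uniqueness at
    the nodal values.\<close>
  have V: "Ustar y \<in> \<Omega>" for y
    using assms(12) by (auto simp: stationary_solution_on_def)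
  have flux: "reconstructed_flux \<Omega> F S H x r s R (\<lambda>j. Ustar (x j)) i k = 0" for i k
    using reconstructed_flux_eq_R_zeros[where x = x and i = i and V = Ustar, OF assms(10)[OF V] assms(12)] assms(11) by simp
  \<comment> \<open>With full domain the stencil test in \<open>semi_discrete_rhs\<close> succeeds
    at every node, which selects the flux branch rather than \<open>alt\<close>.\<close>
  have "dom (local_stationary \<Omega> F S H x (\<lambda>j. Ustar (x j)) i) = UNIV" for i
    using local_stationary_eq_global[where x = x and i = i and V = Ustar, OF assms(10)[OF V] assms(12)] by (simp add: dom_def)
  with flux V show ?thesis
    by (simp add: equilibrium_def semi_discrete_rhs_def flux_right_def flux_left_def)
qed

end
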